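(* Let $\phi:\overline M\to M$ be a (surjective) Riemannian submersion, $\overline r$ a retraction on $\overline M$ and $f$ a function on $M$. If for an initial point $p_0\in\overline M$ and a step $\eta>0$ the sequence $$p_{t+1}=\overline r_{p_t}\big(-\eta\,\mathrm{grad}(f\circ\phi)(p_t)\big)$$ converges to a critical point $p^*$ of $f\circ\phi$ on $\overline M$ as $$d_{\overline M}(p_t,p^* )\le\frac{C}{t^{r}}$$ for some constants $C,r>0$, then the sequence of points $x_t=\phi(p_t)$ converges to the critical point $x^*=\phi(p^* )$ of $f$ on $M$ at the same rate: $$d_M(x_t,x^* )\le\frac{C}{t^{r}}.$$
   Context: All objects are smooth; submersions are assumed surjective. A Riemannian submersion $\phi:(\overline M,\overline g)\to(M,g)$ is a submersion such that for every $p$ the restriction of $(\mathrm{d}\phi)_p$ to the horizontal space $\mathcal H_p=(\ker(\mathrm{d}\phi)_p)^\perp$ is a linear isometry onto $T_{\phi(p)}M$. A retraction on $\overline M$ is a map $\overline r:T\overline M\to\overline M$ with $\overline r_p(0)=p$ and $(\mathrm{d}\overline r_p)_0=\mathrm{Id}$ for every $p$. $d_{\overline M},d_M$ denote the Riemannian distances. The gradient of $f\circ\phi$ is with respect to $\overline g$. *)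

theory Defs
  imports "HOL-Analysis.Analysis"
begin

section \<open>Smooth maps and manifolds\<close>

(* On finite-dimensional domains, continuity of all iterated directional derivatives
   is the usual C^n condition. Only used for open S. *)
primrec Ck_on :: "nat \<Rightarrow> 'e::real_normed_vector set \<Rightarrow> ('e \<Rightarrow> 'f::real_normed_vector) \<Rightarrow> bool" where
  "Ck_on 0 S f \<longleftrightarrow> continuous_on S f"
| "Ck_on (Suc n) S f \<longleftrightarrow> (\<forall>x\<in>S. f differentiable (at x)) \<and>
     (\<forall>v. Ck_on n S (\<lambda>x. frechet_derivative f (at x) v))"

definition smooth_on :: "'e::real_normed_vector set \<Rightarrow> ('e \<Rightarrow> 'f::real_normed_vector) \<Rightarrow> bool" where
  "smooth_on S f \<longleftrightarrow> (\<forall>n. Ck_on n S f)"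

(* A chart is a pair (U, x) of its domain and its coordinate map; x is only relevant on U.
   A manifold is the whole point type together with an atlas. *)
type_synonym ('a, 'e) atlas = "('a set \<times> ('a \<Rightarrow> 'e)) set"

(* The model space is a finite-dimensional inner product space; the class euclidean_space
   would exclude manifolds of dimension 0. *)
definition smooth_manifold ::
  "('a::{t2_space, second_countable_topology}, 'e::real_inner) atlas \<Rightarrow> bool" where
  "smooth_manifold A \<longleftrightarrow>
     (\<exists>D::'e set. finite D \<and> span D = UNIV) \<and>
     (\<Union>(U, x)\<in>A. U) = UNIV \<and>
     (\<forall>(U, x)\<in>A. open U \<and> open (x ` U) \<and> homeomorphism U (x ` U) x (inv_into U x)) \<and>
     (\<forall>(U, x)\<in>A. \<forall>(V, y)\<in>A. smooth_on (x ` (U \<inter> V)) (y \<circ> inv_into U x))"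

definition euclid_atlas :: "('e::real_inner, 'e) atlas" where
  "euclid_atlas = {(UNIV, \<lambda>v. v)}"

(* Only used for open W. *)
definition smooth_map_on ::
  "('a::topological_space, 'd::real_inner) atlas \<Rightarrow> ('b::topological_space, 'e::real_inner) atlas \<Rightarrow>
   'a set \<Rightarrow> ('a \<Rightarrow> 'b) \<Rightarrow> bool" where
  "smooth_map_on A B W F \<longleftrightarrow> continuous_on W F \<and>
     (\<forall>(U, x)\<in>A. \<forall>(V, y)\<in>B. smooth_on (x ` (U \<inter> W \<inter> F -` V)) (y \<circ> F \<circ> inv_into U x))"

abbreviation smooth_map ::
  "('a::topological_space, 'd::real_inner) atlas \<Rightarrow> ('b::topological_space, 'e::real_inner) atlas \<Rightarrow>
   ('a \<Rightarrow> 'b) \<Rightarrow> bool" where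
  "smooth_map A B F \<equiv> smooth_map_on A B UNIV F"

definition smooth_functions :: "('a::topological_space, 'e::real_inner) atlas \<Rightarrow> ('a \<Rightarrow> real) set" where
  "smooth_functions A = {h. smooth_map A euclid_atlas h}"

section \<open>Tangent vectors\<close>

type_synonym 'a tvec = "('a \<Rightarrow> real) \<Rightarrow> real"

(* Tangent vectors at p are the derivations at p of the algebra of smooth functions. They are
   set to 0 outside that algebra, so that equality in HOL is equality of tangent vectors. *)
definition tangent_space ::
  "('a::topological_space, 'e::real_inner) atlas \<Rightarrow> 'a \<Rightarrow> 'a tvec set" where
  "tangent_space A p = {X.
     (\<forall>h. h \<notin> smooth_functions A \<longrightarrow> X h = 0) \<and>
     (\<forall>h\<in>smooth_functions A. \<forall>k\<in>smooth_functions A. \<forall>a b.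
        X (\<lambda>q. a * h q + b * k q) = a * X h + b * X k) \<and>
     (\<forall>h\<in>smooth_functions A. \<forall>k\<in>smooth_functions A.
        X (\<lambda>q. h q * k q) = X h * k p + h p * X k)}"

definition tv_zero :: "'a tvec" where
  "tv_zero = (\<lambda>h. 0)"

definition tv_scale :: "real \<Rightarrow> 'a tvec \<Rightarrow> 'a tvec" where
  "tv_scale c X = (\<lambda>h. c * X h)"

definition tv_add :: "'a tvec \<Rightarrow> 'a tvec \<Rightarrow> 'a tvec" where
  "tv_add X Y = (\<lambda>h. X h + Y h)"

(* The base point is determined by the context: differential B F maps the tangent space at p
   to the tangent space (with respect to B) at F p. *)
definition differential ::
  "('b::topological_space, 'e::real_inner) atlas \<Rightarrow> ('a \<Rightarrow> 'b) \<Rightarrow> 'a tvec \<Rightarrow> 'b tvec" where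
  "differential B F X = (\<lambda>h. if h \<in> smooth_functions B then X (h \<circ> F) else 0)"

definition velocity ::
  "('a::topological_space, 'e::real_inner) atlas \<Rightarrow> (real \<Rightarrow> 'a) \<Rightarrow> real \<Rightarrow> 'a tvec" where
  "velocity A c t = (\<lambda>h. if h \<in> smooth_functions A then deriv (\<lambda>s. h (c s)) t else 0)"

(* The tangent vector at inv_into U x u with components v in the chart (U, x). The maps
   (u, v) |-> (inv_into U x u, coord_vec A U x u v) on x ` U \<times> UNIV are the inverses of the
   standard charts of the tangent bundle. *)
definition coord_vec ::
  "('a::topological_space, 'e::real_inner) atlas \<Rightarrow> 'a set \<Rightarrow> ('a \<Rightarrow> 'e) \<Rightarrow> 'e \<Rightarrow> 'e \<Rightarrow> 'a tvec" where
  "coord_vec A U x u v =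
     (\<lambda>h. if h \<in> smooth_functions A then frechet_derivative (h \<circ> inv_into U x) (at u) v else 0)"

section \<open>Riemannian manifolds\<close>

type_synonym 'a metric_tensor = "'a \<Rightarrow> 'a tvec \<Rightarrow> 'a tvec \<Rightarrow> real"

definition riemannian_manifold ::
  "('a::{t2_space, second_countable_topology}, 'e::real_inner) atlas \<Rightarrow> 'a metric_tensor \<Rightarrow> bool" where
  "riemannian_manifold A g \<longleftrightarrow> smooth_manifold A \<and>
     (\<forall>p. \<forall>X\<in>tangent_space A p. \<forall>Y\<in>tangent_space A p. g p X Y = g p Y X) \<and>
     (\<forall>p. \<forall>X\<in>tangent_space A p. \<forall>Y\<in>tangent_space A p. \<forall>Z\<in>tangent_space A p. \<forall>a b.
        g p (tv_add (tv_scale a X) (tv_scale b Y)) Z = a * g p X Z + b * g p Y Z) \<and>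
     (\<forall>p. \<forall>X\<in>tangent_space A p. X \<noteq> tv_zero \<longrightarrow> g p X X > 0) \<and>
     (\<forall>(U, x)\<in>A. \<forall>v w.
        smooth_on (x ` U) (\<lambda>u. g (inv_into U x u) (coord_vec A U x u v) (coord_vec A U x u w)))"

definition smooth_segment ::
  "('a::topological_space, 'e::real_inner) atlas \<Rightarrow> (real \<Rightarrow> 'a) \<Rightarrow> real \<Rightarrow> real \<Rightarrow> bool" where
  "smooth_segment A \<gamma> a b \<longleftrightarrow>
     (\<exists>J c. open J \<and> {a..b} \<subseteq> J \<and> smooth_map_on euclid_atlas A J c \<and> (\<forall>t\<in>{a..b}. \<gamma> t = c t))"

definition piecewise_smooth_curve ::
  "('a::topological_space, 'e::real_inner) atlas \<Rightarrow> (real \<Rightarrow> 'a) \<Rightarrow> real \<Rightarrow> real \<Rightarrow> bool" where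
  "piecewise_smooth_curve A \<gamma> a b \<longleftrightarrow>
     (\<exists>n \<tau>. \<tau> 0 = a \<and> \<tau> n = b \<and>
        (\<forall>i<n. \<tau> i < \<tau> (Suc i) \<and> smooth_segment A \<gamma> (\<tau> i) (\<tau> (Suc i))))"

(* The velocity is only meaningful away from the finitely many break points and ends,
   which form a null set. *)
definition curve_length ::
  "('a::topological_space, 'e::real_inner) atlas \<Rightarrow> 'a metric_tensor \<Rightarrow> (real \<Rightarrow> 'a) \<Rightarrow> real \<Rightarrow> real \<Rightarrow> ennreal" where
  "curve_length A g \<gamma> a b =
     (\<integral>\<^sup>+t\<in>{a..b}. ennreal (sqrt (g (\<gamma> t) (velocity A \<gamma> t) (velocity A \<gamma> t))) \<partial>lborel)"

(* Extended-valued: the distance of points in different components is infinite. *)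
definition riemannian_dist ::
  "('a::topological_space, 'e::real_inner) atlas \<Rightarrow> 'a metric_tensor \<Rightarrow> 'a \<Rightarrow> 'a \<Rightarrow> ennreal" where
  "riemannian_dist A g p q =
     Inf {curve_length A g \<gamma> a b | \<gamma> a b.
            a < b \<and> piecewise_smooth_curve A \<gamma> a b \<and> \<gamma> a = p \<and> \<gamma> b = q}"

(* dF(X) = X F for a derivation X. *)
definition gradient ::
  "('a::topological_space, 'e::real_inner) atlas \<Rightarrow> 'a metric_tensor \<Rightarrow> ('a \<Rightarrow> real) \<Rightarrow> 'a \<Rightarrow> 'a tvec" where
  "gradient A g F p =
     (THE Z. Z \<in> tangent_space A p \<and> (\<forall>X\<in>tangent_space A p. g p Z X = X F))"

definition critical_point ::
  "('a::topological_space, 'e::real_inner) atlas \<Rightarrow> ('a \<Rightarrow> real) \<Rightarrow> 'a \<Rightarrow> bool" where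
  "critical_point A F p \<longleftrightarrow> (\<forall>X\<in>tangent_space A p. X F = 0)"

section \<open>Riemannian submersions and retractions\<close>

definition vertical_space ::
  "('a::topological_space, 'd::real_inner) atlas \<Rightarrow> ('b::topological_space, 'e::real_inner) atlas \<Rightarrow>
   ('a \<Rightarrow> 'b) \<Rightarrow> 'a \<Rightarrow> 'a tvec set" where
  "vertical_space A B \<phi> p = {X \<in> tangent_space A p. differential B \<phi> X = tv_zero}"

definition horizontal_space ::
  "('a::topological_space, 'd::real_inner) atlas \<Rightarrow> 'a metric_tensor \<Rightarrow>
   ('b::topological_space, 'e::real_inner) atlas \<Rightarrow> ('a \<Rightarrow> 'b) \<Rightarrow> 'a \<Rightarrow> 'a tvec set" where
  "horizontal_space A g B \<phi> p =
     {X \<in> tangent_space A p. \<forall>V\<in>vertical_space A B \<phi> p. g p X V = 0}"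

definition surj_submersion ::
  "('a::topological_space, 'd::real_inner) atlas \<Rightarrow> ('b::topological_space, 'e::real_inner) atlas \<Rightarrow>
   ('a \<Rightarrow> 'b) \<Rightarrow> bool" where
  "surj_submersion A B \<phi> \<longleftrightarrow> smooth_map A B \<phi> \<and> surj \<phi> \<and>
     (\<forall>p. differential B \<phi> ` tangent_space A p = tangent_space B (\<phi> p))"

definition riemannian_submersion ::
  "('a::topological_space, 'd::real_inner) atlas \<Rightarrow> 'a metric_tensor \<Rightarrow>
   ('b::topological_space, 'e::real_inner) atlas \<Rightarrow> 'b metric_tensor \<Rightarrow> ('a \<Rightarrow> 'b) \<Rightarrow> bool" where
  "riemannian_submersion A g B k \<phi> \<longleftrightarrow> surj_submersion A B \<phi> \<and>
     (\<forall>p. bij_betw (differential B \<phi>) (horizontal_space A g B \<phi> p) (tangent_space B (\<phi> p)) \<and>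
          (\<forall>X\<in>horizontal_space A g B \<phi> p. \<forall>Y\<in>horizontal_space A g B \<phi> p.
             k (\<phi> p) (differential B \<phi> X) (differential B \<phi> Y) = g p X Y))"

(* The last conjunct is d(r_p)_0 = Id: the tangent space of the vector space T_pM at 0 is
   identified with T_pM by sending X to the velocity at 0 of the curve t |-> tX. *)
definition manifold_retraction ::
  "('a::topological_space, 'e::real_inner) atlas \<Rightarrow> ('a \<Rightarrow> 'a tvec \<Rightarrow> 'a) \<Rightarrow> bool" where
  "manifold_retraction A r \<longleftrightarrow>
     (\<forall>(U, x)\<in>A. smooth_map_on euclid_atlas A (x ` U \<times> UNIV)
        (\<lambda>(u, v). r (inv_into U x u) (coord_vec A U x u v))) \<and>
     (\<forall>p. r p tv_zero = p) \<and>
     (\<forall>p. \<forall>X\<in>tangent_space A p. velocity A (\<lambda>t. r p (tv_scale t X)) 0 = X)"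

end

(* The differential of a Riemannian submersion does not increase norms: X and its horizontal part
   have the same image, and the vertical part is orthogonal to the horizontal one. Hence the image
   of a curve is not longer than the curve, and the submersion is 1-Lipschitz for the Riemannian
   distances, which transfers the rate. Criticality descends because every tangent vector of the
   base is the image of one upstairs. *)

theory Submission
  imports Defs
begin

section \<open>Calculus of iterated directional derivatives\<close>

text \<open>\<open>frechet_derivative\<close> is a choice among all derivatives at the point, and
  both functions have the same ones near \<open>x\<close>; so the values agree even where no
  derivative exists.\<close>

lemma frechet_derivative_cong_open:
  assumes "open S" "x \<in> S" "\<And>y. y \<in> S \<Longrightarrow> f y = g y"
  shows "frechet_derivative f (at x) = frechet_derivative g (at x)"
proof -
  have "(f has_derivative D) (at x) \<longleftrightarrow> (g has_derivative D) (at x)" for D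
    using assms has_derivative_transform_within_open[of f D x UNIV S g]
      has_derivative_transform_within_open[of g D x UNIV S f] by auto
  then show ?thesis by (simp add: frechet_derivative_def)
qed

lemma Ck_on_subset: "Ck_on n S f \<Longrightarrow> T \<subseteq> S \<Longrightarrow> Ck_on n T f"
proof (induction n arbitrary: f)
  case 0
  then show ?case by (auto intro: continuous_on_subset)
next
  case (Suc n)
  then show ?case by auto
qed

lemma Ck_on_cong:
  assumes "open S" "\<And>x. x \<in> S \<Longrightarrow> f x = g x" "Ck_on n S f"
  shows "Ck_on n S g"
  using assms(2,3)
proof (induction n arbitrary: f g)
  case 0
  then show ?case by (simp cong: continuous_on_cong)
next
  case (Suc n)
  have "g differentiable (at x)" if "x \<in> S" for x
  proof -
    from Suc.prems(2) that obtain D where "(f has_derivative D) (at x)"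
      by (auto simp: differentiable_def)
    then have "(g has_derivative D) (at x)"
      using Suc.prems(1) that assms(1)
      by (auto intro: has_derivative_transform_within_open[of f D x UNIV S g])
    then show ?thesis by (auto simp: differentiable_def)
  qed
  moreover have "Ck_on n S (\<lambda>x. frechet_derivative g (at x) v)" for v
  proof (rule Suc.IH)
    show "Ck_on n S (\<lambda>x. frechet_derivative f (at x) v)" using Suc.prems(2) by simp
    show "frechet_derivative f (at x) v = frechet_derivative g (at x) v" if "x \<in> S" for x
      using frechet_derivative_cong_open[OF assms(1) that Suc.prems(1)] by simp
  qed
  ultimately show ?case by simp
qed

text \<open>Derivatives are taken \<open>at x\<close> in the whole space, so the condition at a
  point depends only on the map nearby. This allows charts to be chosen separately around each
  point.\<close>

lemma Ck_on_local:
  assumes "\<And>x. x \<in> S \<Longrightarrow> \<exists>T. open T \<and> x \<in> T \<and> Ck_on n T f"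
  shows "Ck_on n S f"
  using assms
proof (induction n arbitrary: f)
  case 0
  show ?case
    unfolding Ck_on.simps
  proof (rule continuous_at_imp_continuous_on, rule ballI)
    fix x assume "x \<in> S"
    with 0 obtain T where "open T" "x \<in> T" "continuous_on T f" by force
    then show "isCont f x" by (simp add: continuous_on_eq_continuous_at)
  qed
next
  case (Suc n)
  have "Ck_on n S (\<lambda>x. frechet_derivative f (at x) v)" for v
    by (rule Suc.IH) (use Suc.prems in fastforce)
  moreover have "\<forall>x\<in>S. f differentiable (at x)"
    using Suc.prems by fastforce
  ultimately show ?case by simp
qed

lemma Ck_on_SucD: "Ck_on (Suc n) S f \<Longrightarrow> Ck_on n S f"
proof (induction n arbitrary: f)
  case 0
  then show ?case
    by (auto intro!: continuous_at_imp_continuous_on differentiable_imp_continuous_within)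
next
  case (Suc n)
  show ?case
    using Suc.prems Suc.IH[of "\<lambda>x. frechet_derivative f (at x) v" for v]
    unfolding Ck_on.simps(2)[of "Suc n"] Ck_on.simps(2)[of n S f] by blast
qed

lemma Ck_on_const: "Ck_on n S (\<lambda>x. c)"
proof (induction n arbitrary: c)
  case (Suc n)
  have "frechet_derivative (\<lambda>x. c) (at x) = (\<lambda>_. 0)" for x
    using frechet_derivative_at[OF has_derivative_const[of c "at x"]] by simp
  then show ?case using Suc[of 0] by simp
qed simp

text \<open>Uniqueness of derivatives replaces the choice term \<open>frechet_derivative\<close> by
  an explicit \<open>D\<close>, to which the differentiation rules apply.\<close>

lemma Ck_on_SucI:
  assumes "open S"
    and "\<And>x. x \<in> S \<Longrightarrow> (f has_derivative D x) (at x)"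
    and "\<And>v. Ck_on n S (\<lambda>x. D x v)"
  shows "Ck_on (Suc n) S f"
proof -
  have "frechet_derivative f (at x) v = D x v" if "x \<in> S" for x v
    using frechet_derivative_at[OF assms(2)[OF that]] by simp
  then have "Ck_on n S (\<lambda>x. frechet_derivative f (at x) v)" for v
    by (intro Ck_on_cong[OF assms(1) _ assms(3)[of v]]) simp
  then show ?thesis using assms(2) by (auto simp: differentiable_def)
qed

lemma Ck_on_SucE:
  assumes "Ck_on (Suc n) S f" "x \<in> S"
  shows "(f has_derivative frechet_derivative f (at x)) (at x)"
  using assms by (simp add: frechet_derivative_works[symmetric])

section \<open>Closure of C^n maps under sums, products and composition\<close>

lemma Ck_on_add:
  assumes "open S" "Ck_on n S f" "Ck_on n S g"
  shows "Ck_on n S (\<lambda>x. f x + g x)"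
  using assms(2,3)
proof (induction n arbitrary: f g)
  case 0
  then show ?case by (auto intro: continuous_on_add)
next
  case (Suc n)
  show ?case
  proof (rule Ck_on_SucI[OF assms(1)])
    show "((\<lambda>x. f x + g x) has_derivative
      (\<lambda>v. frechet_derivative f (at x) v + frechet_derivative g (at x) v)) (at x)" if "x \<in> S" for x
      using Suc.prems that by (intro has_derivative_add Ck_on_SucE)
  qed (use Suc in simp)
qed

lemma Ck_on_scaleR:
  fixes f :: "'e::real_normed_vector \<Rightarrow> real"
  assumes "open S" "Ck_on n S f" "Ck_on n S g"
  shows "Ck_on n S (\<lambda>x. f x *\<^sub>R g x)"
  using assms(2,3)
proof (induction n arbitrary: f g)
  case 0
  then show ?case by (auto intro: continuous_on_scaleR)
next
  case (Suc n)
  show ?case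
  proof (rule Ck_on_SucI[OF assms(1)])
    show "((\<lambda>x. f x *\<^sub>R g x) has_derivative
      (\<lambda>v. f x *\<^sub>R frechet_derivative g (at x) v + frechet_derivative f (at x) v *\<^sub>R g x)) (at x)"
      if "x \<in> S" for x
      using Suc.prems that by (intro has_derivative_scaleR Ck_on_SucE)
    show "Ck_on n S (\<lambda>x. f x *\<^sub>R frechet_derivative g (at x) v + frechet_derivative f (at x) v *\<^sub>R g x)"
      for v
      \<comment> \<open>The product rule also contains the undifferentiated factors, which enter the
        induction hypothesis at order \<open>n\<close> only.\<close>
      using Suc.prems Ck_on_SucD[OF Suc.prems(1)] Ck_on_SucD[OF Suc.prems(2)]
      by (intro Ck_on_add[OF assms(1)] Suc.IH) auto
  qed
qed

lemma Ck_on_sum: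
  assumes "open S" "\<And>i. i \<in> I \<Longrightarrow> Ck_on n S (f i)"
  shows "Ck_on n S (\<lambda>x. \<Sum>i\<in>I. f i x)"
  using assms(2)
  by (induction I rule: infinite_finite_induct) (auto intro: Ck_on_const Ck_on_add[OF assms(1)])

text \<open>Pairing with a fixed vector commutes with differentiation; it serves to extract the
  coordinates of a derivative along an orthogonal family.\<close>

lemma Ck_on_inner:
  assumes "open S" "Ck_on n S f"
  shows "Ck_on n S (\<lambda>x. f x \<bullet> b)"
  using assms(2)
proof (induction n arbitrary: f)
  case 0
  then show ?case by (auto intro: continuous_intros)
next
  case (Suc n)
  show ?case
  proof (rule Ck_on_SucI[OF assms(1)])
    show "((\<lambda>x. f x \<bullet> b) has_derivative (\<lambda>v. frechet_derivative f (at x) v \<bullet> b)) (at x)"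
      if "x \<in> S" for x
      using Suc.prems that by (intro has_derivative_inner_left Ck_on_SucE)
  qed (use Suc in simp)
qed

(* Zero vectors are allowed in B: their summands vanish because of x / 0 = 0. *)
lemma finite_span_orthogonal_expansion:
  fixes D :: "'e::real_inner set"
  assumes "finite D" "span D = UNIV"
  obtains B :: "'e set" where "finite B" "\<forall>w. w = (\<Sum>b\<in>B. ((w \<bullet> b) / (b \<bullet> b)) *\<^sub>R b)"
proof -
  obtain B :: "'e set" where B: "finite B" "span B = UNIV" "pairwise orthogonal B"
    using basis_orthogonal[OF assms(1)] assms(2) by auto
  have "w = (\<Sum>b\<in>B. ((w \<bullet> b) / (b \<bullet> b)) *\<^sub>R b)" for w
  proof -
    have "w \<in> span B" using B(2) by simp
    then obtain c where w: "w = (\<Sum>b\<in>B. c b *\<^sub>R b)"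
      using span_finite[OF B(1)] by auto
    \<comment> \<open>Orthogonality isolates the coefficient of \<open>a\<close>.\<close>
    have "w \<bullet> a = c a * (a \<bullet> a)" if "a \<in> B" for a
    proof -
      have "w \<bullet> a = (\<Sum>b\<in>B. c b * (b \<bullet> a))" by (simp add: w inner_sum_left)
      also have "\<dots> = (\<Sum>b\<in>B. if b = a then c a * (a \<bullet> a) else 0)"
        using B(3) that by (intro sum.cong refl) (auto simp: pairwise_def orthogonal_def)
      finally show ?thesis using that B(1) by simp
    qed
    then have "((w \<bullet> a) / (a \<bullet> a)) *\<^sub>R a = c a *\<^sub>R a" if "a \<in> B" for a
      using that by (cases "a = 0") auto
    then show ?thesis using w by (metis (no_types, lifting) sum.cong)
  qed
  with B(1) that show ?thesis by blast
qed

text \<open>Induction on the order with \<open>F\<close> fixed and \<open>G\<close> varying: the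
  partial derivatives of \<open>G\<close> are composed with the same \<open>F\<close> again. The
  spanning set \<open>D\<close> lies in the intermediate space, where the chain rule is
  expanded.\<close>

lemma Ck_on_compose:
  fixes F :: "'c::real_normed_vector \<Rightarrow> 'e::real_inner" and D :: "'e set"
  assumes "finite D" "span D = UNIV" "open S" "F ` S \<subseteq> T"
    and "Ck_on n T G" "Ck_on n S F"
  shows "Ck_on n S (\<lambda>x. G (F x))"
proof -
  obtain B :: "'e set" where B: "finite B" "\<forall>w. w = (\<Sum>b\<in>B. ((w \<bullet> b) / (b \<bullet> b)) *\<^sub>R b)"
    by (rule finite_span_orthogonal_expansion[OF assms(1,2)])
  show ?thesis
    using assms(5,6)
  proof (induction n arbitrary: G)
    case 0
    then show ?case using assms(4)
      by (auto intro: continuous_on_compose2)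
  next
    case (Suc n)
    let ?w = "\<lambda>x v. frechet_derivative F (at x) v"
    let ?D = "\<lambda>x v. \<Sum>b\<in>B. ((1 / (b \<bullet> b)) * (?w x v \<bullet> b)) *\<^sub>R frechet_derivative G (at (F x)) b"
    (* The chain rule, expanded in B so that only the partial derivatives of G in fixed
       directions occur, to which the induction hypothesis applies. *)
    show ?case
    proof (rule Ck_on_SucI[OF assms(3)])
      fix x assume x: "x \<in> S"
      let ?L = "frechet_derivative G (at (F x))"
      have G: "(G has_derivative ?L) (at (F x))"
        using Suc.prems(1) x assms(4) by (intro Ck_on_SucE) auto
      have L: "linear ?L" by (rule has_derivative_linear[OF G])
      have "?L (?w x v) = ?D x v" for v
      proof -
        have "?L (?w x v) = ?L (\<Sum>b\<in>B. ((?w x v \<bullet> b) / (b \<bullet> b)) *\<^sub>R b)"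
          using B(2)[rule_format, of "?w x v"] by simp
        then show ?thesis by (simp add: linear_sum[OF L] linear_cmul[OF L])
      qed
      then show "((\<lambda>x. G (F x)) has_derivative ?D x) (at x)"
        using has_derivative_compose[OF Ck_on_SucE[OF Suc.prems(2) x] G] by simp
    next
      fix v
      have "Ck_on n S (\<lambda>x. frechet_derivative G (at (F x)) b)" for b
        using Suc.prems(1) Ck_on_SucD[OF Suc.prems(2)] by (intro Suc.IH) auto
      moreover have "Ck_on n S (\<lambda>x. (1 / (b \<bullet> b)) * (?w x v \<bullet> b))" for b
        using Ck_on_scaleR[OF assms(3) Ck_on_const Ck_on_inner[OF assms(3)], of n "\<lambda>x. ?w x v" "1 / (b \<bullet> b)" b]
          Suc.prems(2) by simp
      ultimately show "Ck_on n S (\<lambda>x. ?D x v)"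
        by (intro Ck_on_sum Ck_on_scaleR assms(3))
    qed
  qed
qed

section \<open>Smooth maps between manifolds\<close>

lemma smooth_manifold_chart:
  assumes "smooth_manifold A" "(U, x) \<in> A"
  shows "open U" "open (x ` U)" "homeomorphism U (x ` U) x (inv_into U x)"
  using assms unfolding smooth_manifold_def by auto

lemma smooth_manifold_chart_at:
  assumes "smooth_manifold A"
  obtains U x where "(U, x) \<in> A" "q \<in> U"
proof -
  have "q \<in> (\<Union>(U, x)\<in>A. U)" using assms by (simp add: smooth_manifold_def)
  then show thesis using that by auto
qed

lemma open_chart_image:
  assumes "smooth_manifold A" "(U, x) \<in> A" "open W"
  shows "open (x ` (U \<inter> W))"
proof -
  have "openin (top_of_set (x ` U)) (x ` (U \<inter> W))"
    using homeomorphism_imp_open_map[OF smooth_manifold_chart(3)[OF assms(1,2)]] assms(3)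
    by (simp add: openin_open_Int)
  then show ?thesis
    using smooth_manifold_chart(2)[OF assms(1,2)] openin_open_trans by blast
qed

lemma inv_into_chart:
  assumes "smooth_manifold A" "(U, x) \<in> A" "q \<in> U"
  shows "inv_into U x (x q) = q"
  using smooth_manifold_chart(3)[OF assms(1,2)] assms(3) by (simp add: homeomorphism_def)

text \<open>Around each point, a chart \<open>(Q, y)\<close> at the image under \<open>F\<close> is
  inserted; the coordinate form of \<open>G \<circ> F\<close> then factors into those of
  \<open>F\<close> and \<open>G\<close>.\<close>

lemma smooth_map_on_compose:
  fixes A :: "('a::{t2_space, second_countable_topology}, 'c::real_inner) atlas"
    and B :: "('b::{t2_space, second_countable_topology}, 'd::real_inner) atlas"
    and C :: "('m::{t2_space, second_countable_topology}, 'e::real_inner) atlas"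
  assumes A: "smooth_manifold A" and B: "smooth_manifold B" and C: "smooth_manifold C"
    and W: "open W" and F: "smooth_map_on A B W F" and G: "smooth_map B C G"
  shows "smooth_map_on A C W (G \<circ> F)"
  unfolding smooth_map_on_def
proof (intro conjI ballI, safe)
  have Fc: "continuous_on W F" and Gc: "continuous_on UNIV G"
    using F G by (auto simp: smooth_map_on_def)
  then show "continuous_on W (G \<circ> F)"
    by (intro continuous_on_compose) (auto intro: continuous_on_subset)
  obtain D :: "'d set" where D: "finite D" "span D = UNIV"
    using B by (auto simp: smooth_manifold_def)
  fix U x V z assume Ux: "(U, x) \<in> A" and Vz: "(V, z) \<in> C"
  let ?h = "z \<circ> (G \<circ> F) \<circ> inv_into U x"
  show "smooth_on (x ` (U \<inter> W \<inter> (G \<circ> F) -` V)) ?h"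
    unfolding smooth_on_def
  proof (intro allI Ck_on_local)
    fix n u assume "u \<in> x ` (U \<inter> W \<inter> (G \<circ> F) -` V)"
    then obtain q where q: "u = x q" "q \<in> U" "q \<in> W" "G (F q) \<in> V" by auto
    obtain Q y where Qy: "(Q, y) \<in> B" "F q \<in> Q"
      by (rule smooth_manifold_chart_at[OF B])
    \<comment> \<open>\<open>?P\<close> is where the coordinate form of \<open>G\<close> from
      \<open>y\<close> to \<open>z\<close> is defined, and \<open>?N\<close> is the neighbourhood of
      \<open>q\<close> that \<open>F\<close> sends into it.\<close>
    let ?P = "Q \<inter> UNIV \<inter> G -` V"
    let ?N = "U \<inter> (W \<inter> F -` ?P)"
    have "open (G -` V)"
      using Gc smooth_manifold_chart(1)[OF C Vz] by (simp add: open_vimage)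
    then have "open ?P"
      using smooth_manifold_chart(1)[OF B Qy(1)] by auto
    then have "open (W \<inter> F -` ?P)"
      using Fc W continuous_on_open_vimage by (metis Int_commute)
    then have opN: "open (x ` ?N)"
      by (rule open_chart_image[OF A Ux])
    have 1: "Ck_on n (y ` ?P) (z \<circ> G \<circ> inv_into Q y)"
      using G Qy(1) Vz unfolding smooth_map_on_def smooth_on_def by fast
    have "Ck_on n (x ` (U \<inter> W \<inter> F -` Q)) (y \<circ> F \<circ> inv_into U x)"
      using F Ux Qy(1) unfolding smooth_map_on_def smooth_on_def by fast
    then have 2: "Ck_on n (x ` ?N) (y \<circ> F \<circ> inv_into U x)"
      by (rule Ck_on_subset) auto
    have inv: "inv_into U x (x s) = s" if "s \<in> U" for s
      by (rule inv_into_chart[OF A Ux that])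
    have "Ck_on n (x ` ?N) (\<lambda>s. (z \<circ> G \<circ> inv_into Q y) ((y \<circ> F \<circ> inv_into U x) s))"
      by (rule Ck_on_compose[OF D opN _ 1 2]) (auto simp: inv)
    then have "Ck_on n (x ` ?N) ?h"
      by (rule Ck_on_cong[OF opN, rotated]) (auto simp: inv inv_into_chart[OF B Qy(1)])
    moreover have "u \<in> x ` ?N" using q Qy(2) by auto
    ultimately show "\<exists>T. open T \<and> u \<in> T \<and> Ck_on n T ?h" using opN by blast
  qed
qed

lemma inv_into_UNIV_ident: "inv_into UNIV (\<lambda>v. v) = (\<lambda>v. v)"
  by (simp add: inv_into_def fun_eq_iff)

text \<open>With the real line as a manifold, real-valued functions and curves are smooth maps, so
  the one composition lemma covers both.\<close>

lemma smooth_manifold_euclid_real: "smooth_manifold (euclid_atlas :: (real, real) atlas)"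
proof -
  have "Ck_on n UNIV (\<lambda>v::real. v)" for n
  proof (cases n)
    case (Suc m)
    show ?thesis
      unfolding Suc by (rule Ck_on_SucI[where D = "\<lambda>_ v. v"]) (auto intro: Ck_on_const)
  qed simp
  moreover have "finite {1::real} \<and> span {1::real} = UNIV"
    by (auto simp: span_singleton image_iff)
  ultimately show ?thesis
    unfolding smooth_manifold_def euclid_atlas_def
    by (auto simp: inv_into_UNIV_ident smooth_on_def o_def homeomorphism_def)
qed

section \<open>The algebra of smooth functions and its pullback\<close>

lemma smooth_functions_iff:
  "h \<in> smooth_functions A \<longleftrightarrow>
     continuous_on UNIV h \<and> (\<forall>(U, x)\<in>A. \<forall>n. Ck_on n (x ` U) (h \<circ> inv_into U x))"
  by (simp add: smooth_functions_def smooth_map_on_def euclid_atlas_def smooth_on_def o_def)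

lemma smooth_functions_chart:
  "h \<in> smooth_functions A \<Longrightarrow> (U, x) \<in> A \<Longrightarrow> Ck_on n (x ` U) (h \<circ> inv_into U x)"
  by (auto simp: smooth_functions_iff)

text \<open>Ensures that \<open>differential\<close>, which evaluates a vector at
  \<open>h \<circ> \<phi>\<close>, never meets the default value 0 assigned outside the
  algebra.\<close>

lemma smooth_functions_compose:
  assumes "smooth_manifold A" "smooth_manifold B" "smooth_map A B \<phi>" "h \<in> smooth_functions B"
  shows "h \<circ> \<phi> \<in> smooth_functions A"
  using assms(4) unfolding smooth_functions_def mem_Collect_eq
  by (rule smooth_map_on_compose[OF assms(1,2) smooth_manifold_euclid_real open_UNIV assms(3)])

lemma smooth_functions_lincomb:
  assumes "smooth_manifold A" "h \<in> smooth_functions A" "k \<in> smooth_functions A"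
  shows "(\<lambda>q. a * h q + b * k q) \<in> smooth_functions A"
  unfolding smooth_functions_iff
proof (intro conjI ballI, safe)
  show "continuous_on UNIV (\<lambda>q. a * h q + b * k q)"
    using assms(2,3) by (auto simp: smooth_functions_iff intro!: continuous_intros)
  fix U x n assume Ux: "(U, x) \<in> A"
  note op = smooth_manifold_chart(2)[OF assms(1) Ux]
  show "Ck_on n (x ` U) ((\<lambda>q. a * h q + b * k q) \<circ> inv_into U x)"
    using Ck_on_add[OF op Ck_on_scaleR[OF op Ck_on_const smooth_functions_chart[OF assms(2) Ux]]
        Ck_on_scaleR[OF op Ck_on_const smooth_functions_chart[OF assms(3) Ux]], of n a b]
    by (simp add: o_def)
qed

lemma smooth_functions_mult:
  assumes "smooth_manifold A" "h \<in> smooth_functions A" "k \<in> smooth_functions A"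
  shows "(\<lambda>q. h q * k q) \<in> smooth_functions A"
  unfolding smooth_functions_iff
proof (intro conjI ballI, safe)
  show "continuous_on UNIV (\<lambda>q. h q * k q)"
    using assms(2,3) by (auto simp: smooth_functions_iff intro!: continuous_intros)
  fix U x n assume Ux: "(U, x) \<in> A"
  show "Ck_on n (x ` U) ((\<lambda>q. h q * k q) \<circ> inv_into U x)"
    using Ck_on_scaleR[OF smooth_manifold_chart(2)[OF assms(1) Ux]
        smooth_functions_chart[OF assms(2) Ux] smooth_functions_chart[OF assms(3) Ux], of n]
    by (simp add: o_def)
qed

section \<open>Velocities and tangent vectors\<close>

lemma tangent_space_lincomb:
  assumes "X \<in> tangent_space A p" "Y \<in> tangent_space A p"
  shows "tv_add (tv_scale a X) (tv_scale b Y) \<in> tangent_space A p"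
  using assms unfolding tangent_space_def tv_add_def tv_scale_def
  by (simp add: algebra_simps)

text \<open>The derivation laws are linearity and the Leibniz rule for real derivatives along the
  curve. The time is interior because \<open>\<gamma>\<close> agrees with its smooth extension only
  on \<open>{a..b}\<close>.\<close>

lemma velocity_in_tangent_space:
  assumes A: "smooth_manifold A" and seg: "smooth_segment A \<gamma> a b" and t: "a < t" "t < b"
  shows "velocity A \<gamma> t \<in> tangent_space A (\<gamma> t)"
proof -
  obtain J c where J: "open J" "{a..b} \<subseteq> J" and c: "smooth_map_on euclid_atlas A J c"
    and eq: "\<And>s. s \<in> {a..b} \<Longrightarrow> \<gamma> s = c s"
    using seg by (auto simp: smooth_segment_def)
  have "(\<lambda>s. h (\<gamma> s)) differentiable (at t)" if h: "h \<in> smooth_functions A" for h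
  proof -
    have "smooth_map_on euclid_atlas euclid_atlas J (h \<circ> c)"
      using h unfolding smooth_functions_def mem_Collect_eq
      by (rule smooth_map_on_compose[OF smooth_manifold_euclid_real A smooth_manifold_euclid_real J(1) c])
    then have "smooth_on J (h \<circ> c)"
      by (simp add: smooth_map_on_def euclid_atlas_def inv_into_UNIV_ident o_def)
    then have "Ck_on (Suc 0) J (h \<circ> c)" unfolding smooth_on_def by blast
    moreover have "t \<in> J" using J(2) t by auto
    ultimately have "(h \<circ> c) differentiable (at t)" by simp
    then obtain D where "((h \<circ> c) has_derivative D) (at t)" by (auto simp: differentiable_def)
    then have "((\<lambda>s. h (\<gamma> s)) has_derivative D) (at t)"
      by (rule has_derivative_transform_within_open[OF _ open_greaterThanLessThan[of a b]]) (use t eq in auto)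
    then show ?thesis by (auto simp: differentiable_def)
  qed
  then have d: "((\<lambda>s. h (\<gamma> s)) has_real_derivative velocity A \<gamma> t h) (at t)"
    if "h \<in> smooth_functions A" for h
    using that by (simp add: velocity_def DERIV_deriv_iff_real_differentiable)
  \<comment> \<open>By uniqueness, each derivation law reduces to computing one real
    derivative.\<close>
  have v: "velocity A \<gamma> t h = D"
    if "h \<in> smooth_functions A" "((\<lambda>s. h (\<gamma> s)) has_real_derivative D) (at t)" for h D
    using DERIV_unique[OF d[OF that(1)] that(2)] .
  show ?thesis
    unfolding tangent_space_def
  proof (intro CollectI conjI allI impI ballI)
    fix h k a b assume hk: "h \<in> smooth_functions A" "k \<in> smooth_functions A"
    show "velocity A \<gamma> t (\<lambda>q. a * h q + b * k q) = a * velocity A \<gamma> t h + b * velocity A \<gamma> t k"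
      by (rule v[OF smooth_functions_lincomb[OF A hk]])
        (auto intro!: derivative_eq_intros d hk)
    show "velocity A \<gamma> t (\<lambda>q. h q * k q) = velocity A \<gamma> t h * k (\<gamma> t) + h (\<gamma> t) * velocity A \<gamma> t k"
      by (rule v[OF smooth_functions_mult[OF A hk]])
        (auto intro!: derivative_eq_intros d hk)
  qed (simp add: velocity_def)
qed

text \<open>Both sides are the same \<open>deriv\<close> term, so the identity holds for every curve
  and time, including break points where \<open>deriv\<close> is arbitrary.\<close>

lemma velocity_compose:
  assumes "smooth_manifold A" "smooth_manifold B" "smooth_map A B \<phi>"
  shows "velocity B (\<phi> \<circ> \<gamma>) t = differential B \<phi> (velocity A \<gamma> t)"
  using smooth_functions_compose[OF assms] by (auto simp: velocity_def differential_def)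

text \<open>The partition is kept, and the smooth extension of each segment is composed with
  \<open>\<phi>\<close>.\<close>

lemma piecewise_smooth_curve_compose:
  assumes "smooth_manifold A" "smooth_manifold B" "smooth_map A B \<phi>"
    and "piecewise_smooth_curve A \<gamma> a b"
  shows "piecewise_smooth_curve B (\<phi> \<circ> \<gamma>) a b"
proof -
  have "smooth_segment B (\<phi> \<circ> \<gamma>) s t" if seg: "smooth_segment A \<gamma> s t" for s t
  proof -
    obtain J c where J: "open J" "{s..t} \<subseteq> J" "smooth_map_on euclid_atlas A J c"
      and "\<forall>u\<in>{s..t}. \<gamma> u = c u"
      using seg by (auto simp: smooth_segment_def)
    moreover have "smooth_map_on euclid_atlas B J (\<phi> \<circ> c)"
      by (rule smooth_map_on_compose[OF smooth_manifold_euclid_real assms(1,2) J(1,3) assms(3)])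
    ultimately show ?thesis
      unfolding smooth_segment_def by (intro exI[of _ J] exI[of _ "\<phi> \<circ> c"]) auto
  qed
  then show ?thesis using assms(4) unfolding piecewise_smooth_curve_def by blast
qed

(* At break points the velocity need not be a derivation, as deriv is a junk value there. *)
lemma AE_velocity_in_tangent_space:
  assumes A: "smooth_manifold A" and \<gamma>: "piecewise_smooth_curve A \<gamma> a b"
  shows "AE t in lborel. t \<in> {a..b} \<longrightarrow> velocity A \<gamma> t \<in> tangent_space A (\<gamma> t)"
proof -
  obtain n \<tau> where \<tau>: "\<tau> 0 = a" "\<tau> n = b"
    and seg: "\<And>i. i < n \<Longrightarrow> smooth_segment A \<gamma> (\<tau> i) (\<tau> (Suc i))"
    using \<gamma> by (auto simp: piecewise_smooth_curve_def)
  \<comment> \<open>Discrete crossing argument: a sequence that starts at or below \<open>t\<close>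
    and ends above it passes \<open>t\<close> in some step.\<close>
  have between: "\<exists>i<m. \<tau> i \<le> t \<and> t < \<tau> (Suc i)" if "\<tau> 0 \<le> t" "t < \<tau> m" for t m
    using that
  proof (induction m)
    case (Suc m)
    show ?case
    proof (cases "t < \<tau> m")
      case True
      then show ?thesis using Suc.IH[OF Suc.prems(1)] less_Suc_eq by blast
    next
      case False
      then show ?thesis using Suc.prems(2) by (intro exI[of _ m]) simp
    qed
  qed simp
  have "AE t in lborel. \<forall>i\<in>{..n}. t \<noteq> \<tau> i"
    by (rule AE_finite_allI) (auto intro: AE_lborel_singleton)
  then show ?thesis
  proof (rule AE_mp, intro AE_I2 impI)
    fix t assume t: "\<forall>i\<in>{..n}. t \<noteq> \<tau> i" "t \<in> {a..b}"
    \<comment> \<open>The right end \<open>b\<close> is itself the break point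
      \<open>\<tau> n\<close>, so it is already excluded.\<close>
    then have "\<tau> 0 \<le> t" "t < \<tau> n" using \<tau> by (auto simp: less_le)
    from between[OF this] obtain i where i: "i < n" "\<tau> i \<le> t" "t < \<tau> (Suc i)" by blast
    with t(1) have "\<tau> i < t" by (auto simp: less_le)
    then show "velocity A \<gamma> t \<in> tangent_space A (\<gamma> t)"
      using velocity_in_tangent_space[OF A seg[OF i(1)]] i(3) by blast
  qed
qed

section \<open>Riemannian submersions do not increase distances\<close>

text \<open>Pythagoras for X = H + V. The horizontal part \<open>H\<close> is found as the
  horizontal lift of \<open>differential B \<phi> X\<close>, so no orthogonal projection has to be
  constructed; the difference \<open>V\<close> is then vertical.\<close>

lemma riemannian_submersion_contracts:
  assumes R: "riemannian_manifold A g" and S: "riemannian_submersion A g B k \<phi>"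
    and X: "X \<in> tangent_space A p"
  shows "k (\<phi> p) (differential B \<phi> X) (differential B \<phi> X) \<le> g p X X"
proof -
  have "differential B \<phi> X \<in> tangent_space B (\<phi> p)"
    using S X by (auto simp: riemannian_submersion_def surj_submersion_def)
  moreover have "bij_betw (differential B \<phi>) (horizontal_space A g B \<phi> p) (tangent_space B (\<phi> p))"
    using S by (simp add: riemannian_submersion_def)
  ultimately obtain H where H: "H \<in> horizontal_space A g B \<phi> p"
    and HX: "differential B \<phi> H = differential B \<phi> X"
    by (metis (no_types, lifting) bij_betw_def imageE)
  have Ht: "H \<in> tangent_space A p" using H by (simp add: horizontal_space_def)
  \<comment> \<open>This is X - H, written as a linear combination of the form in which linearity of
    the metric is given.\<close>
  define V where "V = tv_add (tv_scale 1 X) (tv_scale (-1) H)"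
  have Vt: "V \<in> tangent_space A p" unfolding V_def by (rule tangent_space_lincomb[OF X Ht])
  have "differential B \<phi> V = tv_zero"
  proof
    fix h
    show "differential B \<phi> V h = tv_zero h"
      using fun_cong[OF HX, of h]
      by (auto simp: differential_def V_def tv_add_def tv_scale_def tv_zero_def)
  qed
  then have HV: "g p H V = 0"
    using H Vt by (auto simp: horizontal_space_def vertical_space_def)
  have sym: "g p Y Z = g p Z Y"
    if "Y \<in> tangent_space A p" "Z \<in> tangent_space A p" for Y Z
    using R that by (simp add: riemannian_manifold_def)
  have lin: "g p (tv_add (tv_scale a Y) (tv_scale b Y')) Z = a * g p Y Z + b * g p Y' Z"
    if "Y \<in> tangent_space A p" "Y' \<in> tangent_space A p" "Z \<in> tangent_space A p" for Y Y' Z a b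
    using R that by (simp add: riemannian_manifold_def)
  have "g p V V \<ge> 0"
  proof (cases "V = tv_zero")
    case True
    \<comment> \<open>Positivity is postulated for nonzero vectors only; linearity with both
      coefficients 0 gives the value 0 here.\<close>
    then have "V = tv_add (tv_scale 0 V) (tv_scale 0 V)"
      by (simp add: tv_add_def tv_scale_def tv_zero_def)
    then show ?thesis using lin[OF Vt Vt Vt, of 0 0] by simp
  next
    case False
    then show ?thesis using R Vt by (auto simp: riemannian_manifold_def less_imp_le)
  qed
  moreover have "X = tv_add (tv_scale 1 H) (tv_scale 1 V)"
    by (auto simp: V_def tv_add_def tv_scale_def)
  then have e: "g p X Z = g p H Z + g p V Z" if "Z \<in> tangent_space A p" for Z
    using lin[OF Ht Vt that, of 1 1] by simp
  \<comment> \<open>Bilinear expansion; symmetry and \<open>HV\<close> remove both cross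
    terms.\<close>
  have "g p X X = g p H H + g p V V"
    using e[OF X] e[OF Ht] e[OF Vt] sym[OF Ht X] sym[OF Vt X] sym[OF Vt Ht] HV by simp
  moreover have "k (\<phi> p) (differential B \<phi> H) (differential B \<phi> H) = g p H H"
    using S H by (simp add: riemannian_submersion_def)
  ultimately show ?thesis using HX by simp
qed

text \<open>The speeds are compared almost everywhere: contraction applies where the velocity is a
  tangent vector, which may fail at break points.\<close>

lemma riemannian_submersion_curve_length_le:
  assumes R: "riemannian_manifold A g" and R': "riemannian_manifold B k"
    and S: "riemannian_submersion A g B k \<phi>" and \<gamma>: "piecewise_smooth_curve A \<gamma> a b"
  shows "curve_length B k (\<phi> \<circ> \<gamma>) a b \<le> curve_length A g \<gamma> a b"
proof -
  have A: "smooth_manifold A" and B: "smooth_manifold B"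
    using R R' by (auto simp: riemannian_manifold_def)
  have \<phi>: "smooth_map A B \<phi>"
    using S by (simp add: riemannian_submersion_def surj_submersion_def)
  show ?thesis
    unfolding curve_length_def
  proof (rule nn_integral_mono_AE, rule AE_mp[OF AE_velocity_in_tangent_space[OF A \<gamma>]],
      intro AE_I2 impI)
    fix t assume t: "t \<in> {a..b} \<longrightarrow> velocity A \<gamma> t \<in> tangent_space A (\<gamma> t)"
    show "ennreal (sqrt (k ((\<phi> \<circ> \<gamma>) t) (velocity B (\<phi> \<circ> \<gamma>) t) (velocity B (\<phi> \<circ> \<gamma>) t))) * indicator {a..b} t
      \<le> ennreal (sqrt (g (\<gamma> t) (velocity A \<gamma> t) (velocity A \<gamma> t))) * indicator {a..b} t"
    proof (cases "t \<in> {a..b}")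
      case True
      then show ?thesis
        using t riemannian_submersion_contracts[OF R S, of "velocity A \<gamma> t" "\<gamma> t"]
        by (simp add: velocity_compose[OF A B \<phi>] ennreal_leI)
    qed simp
  qed
qed

text \<open>Every curve competing for the distance upstairs projects to a competitor downstairs on
  the same interval that is not longer. If no curve joins \<open>p\<close> and \<open>q\<close>, the
  right side is the infimum of the empty set, which is infinite.\<close>

lemma riemannian_submersion_dist_le:
  assumes R: "riemannian_manifold A g" and R': "riemannian_manifold B k"
    and S: "riemannian_submersion A g B k \<phi>"
  shows "riemannian_dist B k (\<phi> p) (\<phi> q) \<le> riemannian_dist A g p q"
  unfolding riemannian_dist_def
proof (rule Inf_mono, safe)
  fix \<gamma> :: "real \<Rightarrow> 'a" and a b :: real
  assume *: "a < b" "piecewise_smooth_curve A \<gamma> a b"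
  have "piecewise_smooth_curve B (\<phi> \<circ> \<gamma>) a b"
    using R R' S * by (intro piecewise_smooth_curve_compose[of A])
      (auto simp: riemannian_manifold_def riemannian_submersion_def surj_submersion_def)
  with * riemannian_submersion_curve_length_le[OF R R' S *(2)]
  show "\<exists>l\<in>{curve_length B k \<gamma>' a' b' |\<gamma>' a' b'. a' < b' \<and> piecewise_smooth_curve B \<gamma>' a' b' \<and>
      \<gamma>' a' = \<phi> (\<gamma> a) \<and> \<gamma>' b' = \<phi> (\<gamma> b)}. l \<le> curve_length A g \<gamma> a b"
    by (intro bexI[of _ "curve_length B k (\<phi> \<circ> \<gamma>) a b"] CollectI exI[of _ "\<phi> \<circ> \<gamma>"] exI[of _ a]
        exI[of _ b]) auto
qed

lemma critical_point_submersion: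
  assumes "surj_submersion A B \<phi>" "f \<in> smooth_functions B" "critical_point A (f \<circ> \<phi>) q"
  shows "critical_point B f (\<phi> q)"
  unfolding critical_point_def
proof
  fix Y assume "Y \<in> tangent_space B (\<phi> q)"
  then obtain X where "X \<in> tangent_space A q" "Y = differential B \<phi> X"
    using assms(1) unfolding surj_submersion_def by blast
  \<comment> \<open>Smoothness of \<open>f\<close> selects the proper branch of
    \<open>differential\<close>, so \<open>Y f\<close> is \<open>X (f \<circ> \<phi>)\<close>, which
    vanishes.\<close>
  then show "Y f = 0"
    using assms(2,3) by (simp add: differential_def critical_point_def)
qed

text \<open>The rate starts at t = 1 because division by zero makes \<open>C / real t powr r\<close>
  equal to 0 at t = 0.\<close>

theorem mainTheorem6:
  fixes Abar :: "('a::{t2_space, second_countable_topology}, 'd::real_inner) atlas"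
    and gbar :: "'a metric_tensor"
    and A :: "('b::{t2_space, second_countable_topology}, 'e::real_inner) atlas"
    and g :: "'b metric_tensor"
    and \<phi> :: "'a \<Rightarrow> 'b"
    and rbar :: "'a \<Rightarrow> 'a tvec \<Rightarrow> 'a"
    and f :: "'b \<Rightarrow> real"
    and p :: "nat \<Rightarrow> 'a"
    and p0 pstar :: 'a
    and \<eta> C r :: real
  assumes "riemannian_manifold Abar gbar"
    and "riemannian_manifold A g"
    and "riemannian_submersion Abar gbar A g \<phi>"
    and "manifold_retraction Abar rbar"
    and "f \<in> smooth_functions A"
    and "\<eta> > 0"
    and "p 0 = p0"
    and "\<forall>t. p (Suc t) = rbar (p t) (tv_scale (- \<eta>) (gradient Abar gbar (f \<circ> \<phi>) (p t)))"
    and "p \<longlonglongrightarrow> pstar"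
    and "critical_point Abar (f \<circ> \<phi>) pstar"
    and "C > 0" and "r > 0"
    and "\<forall>t\<ge>1. riemannian_dist Abar gbar (p t) pstar \<le> ennreal (C / real t powr r)"
  shows "(\<lambda>t. \<phi> (p t)) \<longlonglongrightarrow> \<phi> pstar
    \<and> critical_point A f (\<phi> pstar)
    \<and> (\<forall>t\<ge>1. riemannian_dist A g (\<phi> (p t)) (\<phi> pstar) \<le> ennreal (C / real t powr r))"
proof (intro conjI)
  have S: "surj_submersion Abar A \<phi>"
    using assms(3) by (simp add: riemannian_submersion_def)
  \<comment> \<open>Convergence in the manifold topology comes from continuity of
    \<open>\<phi>\<close>; the distance estimate then supplies only the rate.\<close>
  then have "isCont \<phi> pstar"
    by (simp add: surj_submersion_def smooth_map_on_def continuous_on_eq_continuous_at)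
  then show "(\<lambda>t. \<phi> (p t)) \<longlonglongrightarrow> \<phi> pstar"
    using assms(9) by (rule isCont_tendsto_compose)
  show "critical_point A f (\<phi> pstar)"
    by (rule critical_point_submersion[OF S assms(5,10)])
  show "\<forall>t\<ge>1. riemannian_dist A g (\<phi> (p t)) (\<phi> pstar) \<le> ennreal (C / real t powr r)"
    using riemannian_submersion_dist_le[OF assms(1-3)] assms(13) by (blast intro: order_trans)
qed

end
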